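(* Let $x\in\mathbb{R}$, $k\in\mathbb{Z}_{\ge0}$ and $n\in\mathbb{Z}_{>0}$ with $k\le x<k+\frac1n$. Then the $q$-deformation $[x]_q$ is a formal power series of the form $$[x]_q=[k]_q+q^{k+n}+\sum_{i\ge k+n+1}\kappa_i q^i$$ with integer coefficients $\kappa_i$, where $[k]_q=1+q+\cdots+q^{k-1}$ (and $[0]_q=0$).
   Context: For $a\in\mathbb{Z}$ put $[a]_q=\frac{1-q^a}{1-q}$ and $[a]_{q^{-1}}=\frac{1-q^{-a}}{1-q^{-1}}=q^{1-a}[a]_q$. For $x\in\mathbb{R}$ with regular continued fraction expansion $x=[a_1,a_2,a_3,\dots]=a_1+\cfrac{1}{a_2+\cfrac{1}{a_3+\cdots}}$ ($a_1\in\mathbb{Z}$, $a_i\ge1$ for $i\ge2$; finite iff $x$ is rational), the $q$-deformation of $x$ is $$[x]_q=[a_1]_q+\cfrac{q^{a_1}}{[a_2]_{q^{-1}}+\cfrac{q^{-a_2}}{[a_3]_q+\cfrac{q^{a_3}}{[a_4]_{q^{-1}}+\cfrac{q^{-a_4}}{\ddots}}}}.$$ For rational $x$ this is a rational function of $q$ (independent of the choice of the finite expansion), regarded as a Laurent series in $q$; for irrational $x$ the coefficients of the finite truncations stabilize and $[x]_q$ is their limit as a formal Laurent series.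
   Formalization: As stated the claim fails (x = k, or x = 1/3 with k = 0, n = 1, where [x]_q = q^2 − q^3 + …); the formal theorem keeps all hypotheses but includes the term q^{k+n} only when x ≥ k + 1/(n+1), and otherwise its coefficient is 0. *)

theory Defs
  imports Complex_Main "HOL-Computational_Algebra.Formal_Laurent_Series"
begin

section \<open>Regular continued fractions\<close>

text \<open>
  \<^term>\<open>cf_trunc n x\<close> lists the first \<open>n + 1\<close> partial quotients
  of the regular continued fraction of \<open>x\<close>, or all of them if there are fewer.
\<close>

fun cf_trunc :: "nat \<Rightarrow> real \<Rightarrow> int list" where
  "cf_trunc 0 x = [\<lfloor>x\<rfloor>]"
| "cf_trunc (Suc n) x = \<lfloor>x\<rfloor> # (if x \<in> \<int> then [] else cf_trunc n (1 / frac x))"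

fun cf_value :: "int list \<Rightarrow> real" where
  "cf_value [] = 0"
| "cf_value [a] = of_int a"
| "cf_value (a # b # bs) = of_int a + 1 / cf_value (b # bs)"


section \<open>The \<open>q\<close>-deformation\<close>

definition q_int :: "'a::field \<Rightarrow> int \<Rightarrow> 'a" where
  "q_int q a = (1 - q powi a) / (1 - q)"

text \<open>
  The deformed continued fraction alternates between \<open>q\<close> and its inverse; since
  \<open>inverse (inverse q) = q\<close>, this is obtained by inverting the parameter at each level.
\<close>

fun q_cf :: "'a::field \<Rightarrow> int list \<Rightarrow> 'a" where
  "q_cf q [] = 0"
| "q_cf q [a] = q_int q a"
| "q_cf q (a # b # bs) = q_int q a + q powi a / q_cf (inverse q) (b # bs)"

text \<open>
  The limit is taken in the \<open>X\<close>-adic metric of formal Laurent series, that is, coefficients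
  stabilize. For rational \<open>x\<close> the sequence is eventually constant, and evaluating the
  finite continued fraction in the field of Laurent series amounts to expanding the rational
  function at \<open>q = 0\<close>.
\<close>

definition q_real :: "real \<Rightarrow> rat fls" where
  "q_real x = lim (\<lambda>n. q_cf fls_X (cf_trunc n x))"


section \<open>Adequacy of the definitions\<close>

lemma cf_trunc_not_Nil [simp]: "cf_trunc n x \<noteq> []"
  by (cases n) auto

lemma cf_value_Cons: "bs \<noteq> [] \<Longrightarrow> cf_value (a # bs) = of_int a + 1 / cf_value bs"
  by (cases bs) auto

lemma inverse_frac_gt_1: "x \<notin> \<int> \<Longrightarrow> 1 < 1 / frac (x::real)"
  using frac_lt_1[of x] frac_gt_0_iff[of x] by (simp add: field_simps)

lemma cf_trunc_pos:
  assumes "1 \<le> x" "a \<in> set (cf_trunc n x)"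
  shows "1 \<le> a"
  using assms
proof (induction n arbitrary: x)
  case 0
  then show ?case by (simp add: le_floor_iff)
next
  case (Suc n)
  show ?case
  proof (cases "a = \<lfloor>x\<rfloor>")
    case True
    then show ?thesis using Suc.prems by (simp add: le_floor_iff)
  next
    case False
    then have "x \<notin> \<int>" "a \<in> set (cf_trunc n (1 / frac x))"
      using Suc.prems by (auto split: if_splits)
    then show ?thesis using Suc.IH[of "1 / frac x"] inverse_frac_gt_1[of x] by simp
  qed
qed

lemma cf_trunc_tl_pos: "a \<in> set (tl (cf_trunc n x)) \<Longrightarrow> 1 \<le> a"
proof (cases n)
  case (Suc m)
  assume "a \<in> set (tl (cf_trunc n x))"
  with Suc have "x \<notin> \<int>" "a \<in> set (cf_trunc m (1 / frac x))"
    by (auto split: if_splits)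
  then show ?thesis using cf_trunc_pos[of "1 / frac x" a m] inverse_frac_gt_1[of x] by simp
qed simp

lemma cf_value_Suc:
  "x \<notin> \<int> \<Longrightarrow> cf_value (cf_trunc (Suc n) x) = of_int \<lfloor>x\<rfloor> + 1 / cf_value (cf_trunc n (1 / frac x))"
  by (simp add: cf_value_Cons)

lemma cf_value_ge_1: "1 \<le> x \<Longrightarrow> 1 \<le> cf_value (cf_trunc n x)"
proof (induction n arbitrary: x)
  case 0
  then show ?case by (simp add: le_floor_iff)
next
  case (Suc n)
  have f: "1 \<le> real_of_int \<lfloor>x\<rfloor>" using Suc.prems by (simp add: le_floor_iff)
  show ?case
  proof (cases "x \<in> \<int>")
    case True
    then show ?thesis using f by simp
  next
    case False
    have "1 \<le> cf_value (cf_trunc n (1 / frac x))"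
      using Suc.IH inverse_frac_gt_1[OF False] by simp
    then have "0 \<le> 1 / cf_value (cf_trunc n (1 / frac x))" by simp
    then show ?thesis using f cf_value_Suc[OF False, of n] by linarith
  qed
qed

lemma cf_value_error: "\<bar>cf_value (cf_trunc n x) - x\<bar> \<le> 2 * (1/2) ^ n"
proof (induction n arbitrary: x rule: less_induct)
  case (less n)
  have step: "cf_value (cf_trunc (Suc m) z) - z = (w - v) / (v * w)"
    if "z \<notin> \<int>" "w = 1 / frac z" "v = cf_value (cf_trunc m w)" for m z w v
  proof -
    have w: "1 < w" using inverse_frac_gt_1 that by simp
    then have v: "1 \<le> v" using cf_value_ge_1 that by simp
    have "z = of_int \<lfloor>z\<rfloor> + 1 / w" using that by (simp add: frac_def)
    moreover have "cf_value (cf_trunc (Suc m) z) = of_int \<lfloor>z\<rfloor> + 1 / v"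
      using cf_value_Suc that by simp
    ultimately have "cf_value (cf_trunc (Suc m) z) - z = 1 / v - 1 / w" by linarith
    then show ?thesis using v w by (simp add: field_simps)
  qed
  have int: ?case if "x \<in> \<int>"
    using that by (cases n) (auto elim!: Ints_cases)
  consider "n = 0" | "x \<in> \<int>" | "n = 1" "x \<notin> \<int>" | m where "n = Suc (Suc m)" "x \<notin> \<int>"
    by (metis One_nat_def not0_implies_Suc)
  then show ?case
  proof cases
    case 1
    have "\<bar>real_of_int \<lfloor>x\<rfloor> - x\<bar> \<le> 2" by linarith
    with 1 show ?thesis by simp
  next
    case 2
    then show ?thesis by (rule int)
  next
    case 3
    define w where "w = 1 / frac x"
    define v where "v = cf_value (cf_trunc 0 w)"
    have w: "1 < w" using inverse_frac_gt_1 3 w_def by simp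
    have v: "1 \<le> v" using cf_value_ge_1 w v_def less_imp_le by blast
    have vw: "1 \<le> v * w" using v w mult_mono[of 1 v 1 w] by simp
    have "\<bar>w - v\<bar> \<le> 1" unfolding v_def by simp linarith
    then have "\<bar>w - v\<bar> / (v * w) \<le> 1" using vw by (simp add: field_simps)
    then show ?thesis
      using step[OF 3(2) w_def v_def] 3(1) v w by (simp add: abs_mult abs_divide)
  next
    case 4
    define w where "w = 1 / frac x"
    define v where "v = cf_value (cf_trunc (Suc m) w)"
    have w: "1 < w" using inverse_frac_gt_1 4 w_def by simp
    have v: "1 \<le> v" using cf_value_ge_1 w v_def less_imp_le by blast
    have vw: "1 \<le> v * w" using v w mult_mono[of 1 v 1 w] by simp
    have eq: "\<bar>cf_value (cf_trunc n x) - x\<bar> = \<bar>w - v\<bar> / (v * w)"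
      using step[OF 4(2) w_def v_def] 4(1) v w by (simp add: abs_mult abs_divide)
    show ?thesis
    proof (cases "w \<in> \<int>")
      case True
      then have "v = w" unfolding v_def by (auto elim!: Ints_cases)
      then show ?thesis using eq by simp
    next
      case False
      define w' where "w' = 1 / frac w"
      define v' where "v' = cf_value (cf_trunc m w')"
      have w': "1 < w'" using inverse_frac_gt_1 False w'_def by simp
      have v': "1 \<le> v'" using cf_value_ge_1 w' v'_def less_imp_le by blast
      have a: "1 \<le> real_of_int \<lfloor>w\<rfloor>" using w by (simp add: le_floor_iff)
      have W: "w = of_int \<lfloor>w\<rfloor> + 1 / w'" using w'_def by (simp add: frac_def)
      have V: "v = of_int \<lfloor>w\<rfloor> + 1 / v'"
        using cf_value_Suc[OF False, of m] unfolding v_def v'_def w'_def by simp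
      have "w * w' = of_int \<lfloor>w\<rfloor> * w' + 1"
        using w' by (subst W) (simp add: field_simps)
      moreover have "1 * 1 \<le> of_int \<lfloor>w\<rfloor> * w'" using a w' by (intro mult_mono) auto
      ultimately have ww: "2 \<le> w * w'" by linarith
      have "v * v' = of_int \<lfloor>w\<rfloor> * v' + 1"
        using v' by (subst V) (simp add: field_simps)
      moreover have "1 * 1 \<le> of_int \<lfloor>w\<rfloor> * v'" using a v' by (intro mult_mono) auto
      ultimately have vv: "2 \<le> v * v'" by linarith
      have four: "4 \<le> (v * v') * (w * w')" using mult_mono[OF vv ww] vv by simp
      have "\<bar>w - v\<bar> = \<bar>w' - v'\<bar> / (v' * w')"
        using step[OF False w'_def v'_def] v' w' unfolding v_def[symmetric]
        by (metis abs_divide abs_minus_commute abs_of_pos less_le_trans mult_pos_pos zero_less_one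
            less_trans)
      then have "\<bar>cf_value (cf_trunc n x) - x\<bar> = \<bar>w' - v'\<bar> / ((v * v') * (w * w'))"
        using eq by (simp add: mult_ac)
      also have "\<dots> \<le> \<bar>w' - v'\<bar> / 4"
        using four by (intro divide_left_mono) auto
      also have "\<dots> \<le> 2 * (1/2) ^ m / 4"
        using less.IH[of m w'] 4(1) unfolding v'_def by (simp add: abs_minus_commute)
      finally show ?thesis using 4(1) by simp
    qed
  qed
qed

lemma cf_value_tendsto: "(\<lambda>n. cf_value (cf_trunc n x)) \<longlonglongrightarrow> x"
proof -
  have "(\<lambda>n. 2 * (1/2) ^ n :: real) \<longlonglongrightarrow> 2 * 0"
    by (intro tendsto_mult tendsto_const LIMSEQ_power_zero) auto
  then have g: "(\<lambda>n. 2 * (1/2) ^ n :: real) \<longlonglongrightarrow> 0" by simp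
  have "(\<lambda>n. \<bar>cf_value (cf_trunc n x) - x\<bar>) \<longlonglongrightarrow> 0"
    by (rule tendsto_sandwich[OF _ _ tendsto_const g])
      (rule always_eventually, rule allI, rule abs_ge_zero cf_value_error)+
  from LIM_zero_cancel[OF tendsto_rabs_zero_cancel[OF this]] show ?thesis .
qed

lemma cf_trunc_rational:
  assumes "x \<in> \<rat>"
  shows "\<exists>N. cf_value (cf_trunc N x) = x \<and> (\<forall>n\<ge>N. cf_trunc n x = cf_trunc N x)"
proof -
  have "\<exists>N. cf_value (cf_trunc N x) = x \<and> (\<forall>n\<ge>N. cf_trunc n x = cf_trunc N x)"
    if "x = of_int p / of_nat d" "0 < d" for x :: real and p :: int and d :: nat
    using that
  proof (induction d arbitrary: x p rule: less_induct)
    case (less d)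
    show ?case
    proof (cases "x \<in> \<int>")
      case True
      then have "cf_trunc n x = [\<lfloor>x\<rfloor>]" for n by (cases n) auto
      then show ?thesis using True by (auto elim!: Ints_cases)
    next
      case False
      define r where "r = p - \<lfloor>x\<rfloor> * int d"
      have fr: "frac x = of_int r / of_nat d"
        using less.prems by (simp add: frac_def r_def field_simps)
      have "0 < frac x" "frac x < 1" using False frac_lt_1 frac_gt_0_iff by auto
      then have r: "0 < r" "r < int d"
        using less.prems(2) unfolding fr by (auto simp: field_simps)
      have y: "1 / frac x = of_int (int d) / of_nat (nat r)" using r fr by simp
      obtain N where N: "cf_value (cf_trunc N (1 / frac x)) = 1 / frac x"
        "\<And>n. n \<ge> N \<Longrightarrow> cf_trunc n (1 / frac x) = cf_trunc N (1 / frac x)"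
        using less.IH[OF _ y] r by (metis zero_less_nat_eq nat_less_iff less_imp_le)
      have "cf_value (cf_trunc (Suc N) x) = x"
        using cf_value_Suc[OF False, of N] N(1) by (simp add: frac_def)
      moreover have "cf_trunc n x = cf_trunc (Suc N) x" if "n \<ge> Suc N" for n
      proof -
        obtain m where m: "n = Suc m" "m \<ge> N" using \<open>n \<ge> Suc N\<close> by (cases n) auto
        show ?thesis unfolding m(1) cf_trunc.simps N(2)[OF m(2)] ..
      qed
      ultimately show ?thesis by blast
    qed
  qed
  moreover obtain p d where "x = of_int p / of_int d" "d > 0"
    using assms by (auto elim!: Rats_cases')
  then have "x = of_int p / of_nat (nat d)" "0 < nat d" by auto
  ultimately show ?thesis by blast
qed

lemma q_real_rational:
  assumes "x \<in> \<rat>"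
  obtains N where "cf_value (cf_trunc N x) = x" "q_real x = q_cf fls_X (cf_trunc N x)"
proof -
  obtain N where N: "cf_value (cf_trunc N x) = x" "\<forall>n\<ge>N. cf_trunc n x = cf_trunc N x"
    using cf_trunc_rational[OF assms] by blast
  have "(\<lambda>n. q_cf fls_X (cf_trunc n x) :: rat fls) \<longlonglongrightarrow> q_cf fls_X (cf_trunc N x)"
    using N(2) by (intro tendsto_eventually) (metis (mono_tags, lifting) eventually_sequentially)
  then have "q_real x = q_cf fls_X (cf_trunc N x)" unfolding q_real_def by (rule limI)
  with N(1) show ?thesis by (rule that)
qed

text \<open>
  By the next two facts the coefficient of \<open>q ^ (k + n)\<close> in the deformation of
  \<open>x \<in> {k..<k + 1 / n}\<close> need not be \<open>1\<close>: it is \<open>0\<close> for \<open>x = k\<close>, and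
  for \<open>k = 0\<close>, \<open>n = 1\<close>, \<open>x = 1 / 3\<close>.
\<close>

lemma q_real_of_int: "q_real (of_int k) = q_int fls_X k"
proof -
  have "cf_trunc n (of_int k) = [k]" for n by (cases n) auto
  then show ?thesis by (simp add: q_real_def)
qed

lemma q_real_one_third: "q_real (1 / 3) = fls_X ^ 2 / (1 + fls_X + fls_X ^ 2)"
proof -
  have fr: "frac (1 / 3 :: real) = 1 / 3" by (simp add: frac_eq)
  have ni: "(1 / 3 :: real) \<notin> \<int>"
    using fr frac_eq_0_iff[of "1 / 3 :: real"] by simp
  have three: "cf_trunc n 3 = [3]" for n by (cases n) auto
  have "cf_trunc (Suc n) (1 / 3) = [0, 3]" for n
    using ni fr three by simp
  then have "\<forall>n\<ge>1. cf_trunc n (1 / 3) = [0, 3]" by (metis One_nat_def Suc_le_D)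
  then have "(\<lambda>n. q_cf fls_X (cf_trunc n (1 / 3)) :: rat fls) \<longlonglongrightarrow> q_cf fls_X [0, 3]"
    by (intro tendsto_eventually) (auto simp: eventually_sequentially intro!: exI[of _ 1])
  then have "q_real (1 / 3) = q_cf fls_X [0, 3]" unfolding q_real_def by (rule limI)
  also have "\<dots> = fls_X ^ 2 / (1 + fls_X + fls_X ^ 2)"
  proof -
    have X: "(fls_X :: rat fls) \<noteq> 0" "(fls_X :: rat fls) \<noteq> 1"
      by (auto simp: fls_eq_iff intro: exI[of _ 1])
    have "q_cf q [0, 3] = q ^ 2 / (1 + q + q ^ 2)" if "q \<noteq> 0" "q \<noteq> 1" for q :: "rat fls"
    proof -
      have "inverse q \<noteq> 1" using that by (metis inverse_1 inverse_inverse_eq)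
      have "1 - inverse q ^ 3 = (1 + inverse q + inverse q ^ 2) * (1 - inverse q)"
        by (simp add: algebra_simps power2_eq_square power3_eq_cube)
      then have "(1 - inverse q ^ 3) / (1 - inverse q) = 1 + inverse q + inverse q ^ 2"
        using \<open>inverse q \<noteq> 1\<close> by simp
      also have "\<dots> = (1 + q + q ^ 2) / q ^ 2"
        using that by (simp add: field_simps power2_eq_square)
      finally have e: "(1 - inverse q ^ 3) / (1 - inverse q) = (1 + q + q ^ 2) / q ^ 2" .
      have "q_cf q [0, 3] = 1 / ((1 - inverse q ^ 3) / (1 - inverse q))"
        by (simp add: q_int_def power_int_def)
      then show ?thesis unfolding e by simp
    qed
    then show ?thesis using X by blast
  qed
  finally show ?thesis .
qed

end

theory Submission
  imports Defs
begin

text \<open>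
  Two consecutive levels of the deformed continued fraction combine into the map
  \[ g \mapsto [a]_q + \frac{q^a}{[b]_{q^{-1}} + q^{-b} / g}
       = [a]_q + q^{a+b} \frac{g}{1 + q [b]_q g}, \]
  which is free of negative powers of \<open>q\<close>. It preserves integrality of power series and
  multiplies differences by \<open>q ^ (a + b)\<close> up to a unit, so the truncations converge to an integral
  power series. If \<open>g\<close> has constant term 1, as it does for every positive continued fraction, then a
  single application shows that the first correction to \<open>[a]\<^sub>q\<close> is \<open>q ^ (a + b)\<close>. An expansion
  that stops at \<open>b\<close> also has this shape, because \<open>[a, b] = [a, b - 1, 1]\<close>; so for non-integral
  \<open>x = a + 1 / y\<close> the exponent of the correction is always \<open>a + \<lceil>y\<rceil> - 1\<close>.
\<close>

section \<open>Formal power series\<close>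

definition fps_int_coeffs :: "'a::ring_1 fps \<Rightarrow> bool" where
  "fps_int_coeffs f \<longleftrightarrow> (\<forall>i. f $ i \<in> \<int>)"

lemma fps_int_coeffs_add: "fps_int_coeffs f \<Longrightarrow> fps_int_coeffs g \<Longrightarrow> fps_int_coeffs (f + g)"
  by (simp add: fps_int_coeffs_def)

lemma fps_int_coeffs_mult: "fps_int_coeffs f \<Longrightarrow> fps_int_coeffs g \<Longrightarrow> fps_int_coeffs (f * g)"
  by (auto simp: fps_int_coeffs_def fps_mult_nth intro!: Ints_sum)

lemma fps_int_coeffs_0: "fps_int_coeffs 0"
  by (simp add: fps_int_coeffs_def)

lemma fps_int_coeffs_1: "fps_int_coeffs 1"
  by (simp add: fps_int_coeffs_def)

lemma fps_int_coeffs_X_power: "fps_int_coeffs (fps_X ^ n)"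
  by (simp add: fps_int_coeffs_def)

lemma fps_int_coeffs_X: "fps_int_coeffs fps_X"
  using fps_int_coeffs_X_power[of 1] by simp

lemma fps_int_coeffs_inverse:
  fixes f :: "'a::field fps"
  assumes "fps_int_coeffs f" "f $ 0 = 1"
  shows "fps_int_coeffs (inverse f)"
  unfolding fps_int_coeffs_def
proof
  fix i
  show "inverse f $ i \<in> \<int>"
  proof (induction i rule: less_induct)
    case (less i)
    show ?case
    proof (cases i)
      case 0
      then show ?thesis using assms(2) by simp
    next
      case (Suc j)
      have "inverse f $ i = - (\<Sum>l=1..i. f $ l * inverse f $ (i - l))"
        using assms(2) Suc by (simp add: fps_inverse_def)
      also have "\<dots> \<in> \<int>"
        using assms(1) less
        by (intro Ints_minus Ints_sum Ints_mult) (auto simp: fps_int_coeffs_def)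
      finally show ?thesis .
    qed
  qed
qed

lemma fps_int_coeffs_divide:
  fixes f g :: "'a::field fps"
  assumes "fps_int_coeffs f" "fps_int_coeffs g" "g $ 0 = 1"
  shows "fps_int_coeffs (f / g)"
  using assms by (simp add: fps_divide_unit fps_int_coeffs_mult fps_int_coeffs_inverse)

lemma fps_int_coeffs_split_at:
  fixes f g :: "'a::ring_1 fps"
  assumes "fps_int_coeffs f" "\<And>i. i < N \<Longrightarrow> f $ i = g $ i" "\<And>i. N \<le> i \<Longrightarrow> g $ i = 0"
  shows "\<exists>\<kappa>. f = g + Abs_fps (\<lambda>i. if N \<le> i then of_int (\<kappa> i) else 0)"
proof -
  have "\<exists>z. f $ i = of_int z" for i
    using assms(1) by (auto simp: fps_int_coeffs_def elim: Ints_cases)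
  then obtain \<kappa> where "\<And>i. f $ i = of_int (\<kappa> i)" by metis
  with assms(2,3) have "f = g + Abs_fps (\<lambda>i. if N \<le> i then of_int (\<kappa> i) else 0)"
    by (auto simp: fps_eq_iff)
  then show ?thesis by (rule exI[of _ \<kappa>])
qed

lemma fps_X_power_dvd_imp_nth_eq:
  fixes f g :: "'a::comm_ring_1 fps"
  assumes "fps_X ^ n dvd f - g" "i < n"
  shows "f $ i = g $ i"
proof -
  from assms(1) obtain h where "f - g = fps_X ^ n * h" by (rule dvdE)
  then have "f $ i - g $ i = (fps_X ^ n * h) $ i" by (metis fps_sub_nth)
  then show ?thesis using assms(2) by (simp add: fps_X_power_mult_nth)
qed

lemma fps_convergentI:
  fixes f :: "nat \<Rightarrow> 'a::group_add fps"
  assumes "\<And>i. \<exists>N. \<forall>n\<ge>N. f n $ i = f N $ i"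
  shows "convergent f"
proof -
  have "\<forall>i. \<exists>N. \<forall>n\<ge>N. f n $ i = f N $ i" using assms by blast
  from choice[OF this] obtain N where stable: "\<forall>n\<ge>N i. f n $ i = f (N i) $ i" for i
    by blast
  have "f \<longlonglongrightarrow> Abs_fps (\<lambda>i. f (N i) $ i)"
  proof (rule tendsto_fpsI)
    show "\<forall>\<^sub>F n in sequentially. f n $ i = Abs_fps (\<lambda>i. f (N i) $ i) $ i" for i
      using stable[of i] unfolding eventually_sequentially fps_nth_Abs_fps by blast
  qed
  then show ?thesis by (rule convergentI)
qed

lemma fps_nth_limit_mem:
  fixes f :: "'b \<Rightarrow> 'a::group_add fps"
  assumes "(f \<longlongrightarrow> l) F" "F \<noteq> bot" "\<forall>\<^sub>F x in F. f x $ i \<in> S"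
  shows "l $ i \<in> S"
proof -
  have "\<forall>\<^sub>F x in F. f x $ i = l $ i" using assms(1) by (simp add: tendsto_fps_iff)
  with assms(3) have "\<forall>\<^sub>F x in F. l $ i \<in> S" by eventually_elim simp
  with assms(2) show ?thesis by simp
qed

lemma fps_int_coeffs_limit:
  fixes f :: "'b \<Rightarrow> 'a::ring_1 fps"
  assumes "(f \<longlongrightarrow> l) F" "F \<noteq> bot" "\<And>x. fps_int_coeffs (f x)"
  shows "fps_int_coeffs l"
  using assms(3) unfolding fps_int_coeffs_def
  by (intro allI fps_nth_limit_mem[OF assms(1,2)] always_eventually) blast

lemma tendsto_fps_to_fls:
  fixes f :: "'b \<Rightarrow> 'a::ab_group_add fps"
  assumes "(f \<longlongrightarrow> l) F"
  shows "((\<lambda>x. fps_to_fls (f x)) \<longlongrightarrow> fps_to_fls l) F"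
proof -
  have "dist (fps_to_fls g) (fps_to_fls h) = dist g h" for g h :: "'a fps"
    by (simp add: dist_fls_def dist_fps_def fls_subdegree_fls_to_fps flip: fps_to_fls_minus)
  with assms show ?thesis
    by (simp add: tendsto_dist_iff[of _ l] tendsto_dist_iff[of _ "fps_to_fls l"])
qed

section \<open>Deformed continued fractions over a field\<close>

lemma q_int_1: "q \<noteq> 1 \<Longrightarrow> q_int q 1 = 1"
  by (simp add: q_int_def)

lemma q_int_add_1:
  assumes "q \<noteq> 0" "q \<noteq> 1"
  shows "q_int q (a + 1) = q_int q a + q powi a"
proof -
  have "1 - q powi (a + 1) = (1 - q powi a) + q powi a * (1 - q)"
    using assms(1) by (simp add: power_int_add algebra_simps)
  then have "q_int q (a + 1) = ((1 - q powi a) + q powi a * (1 - q)) / (1 - q)"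
    by (simp only: q_int_def)
  with assms(2) show ?thesis by (simp add: q_int_def add_divide_distrib)
qed

lemma q_int_inverse:
  assumes "q \<noteq> 0" "q \<noteq> 1"
  shows "q_int (inverse q) a = q * q_int q a / q powi a"
proof -
  have "1 - q \<noteq> 0" "q - 1 \<noteq> 0" using assms(2) by auto
  then have "(1 - inverse p) / (1 - inverse q) = q * ((1 - p) / (1 - q)) / p" if "p \<noteq> 0" for p
    using assms(1) that by (simp add: field_simps)
  with assms(1) show ?thesis by (simp add: q_int_def power_int_inverse)
qed

lemma q_cf_Cons: "bs \<noteq> [] \<Longrightarrow> q_cf q (a # bs) = q_int q a + q powi a / q_cf (inverse q) bs"
  by (cases bs) auto

lemma q_cf_split_last:
  assumes "q \<noteq> 0" "q \<noteq> 1"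
  shows "q_cf q (as @ [a + 1]) = q_cf q (as @ [a, 1])"
  using assms
proof (induction as arbitrary: q)
  case Nil
  then have "inverse q \<noteq> 1" by (metis inverse_1 inverse_inverse_eq)
  with Nil show ?case by (simp add: q_int_add_1 q_int_1)
next
  case (Cons b as)
  then have "inverse q \<noteq> 0" "inverse q \<noteq> 1"
    by (auto dest: arg_cong[of _ _ inverse])
  then show ?case by (simp add: q_cf_Cons Cons.IH)
qed

lemma q_cf_two_levels:
  assumes "q \<noteq> 0" "q \<noteq> 1" "bs \<noteq> []" "q_cf q bs \<noteq> 0"
  shows "q_cf q (a # b # bs)
    = q_int q a + q powi (a + b) * (q_cf q bs / (1 + q * q_int q b * q_cf q bs))"
proof -
  let ?B = "q_int q b" and ?g = "q_cf q bs"
  have "q_cf q (a # b # bs)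
      = q_int q a + q powi a / (q_int (inverse q) b + inverse q powi b / ?g)"
    using assms(3) by (simp add: q_cf_Cons)
  also have "q_int (inverse q) b + inverse q powi b / ?g = q * ?B / q powi b + 1 / (q powi b * ?g)"
    using assms(1,2) by (simp add: q_int_inverse power_int_inverse divide_inverse)
  also have "\<dots> = (1 + q * ?B * ?g) / (q powi b * ?g)"
    using assms(1,4) by (simp add: add_divide_distrib)
  finally show ?thesis using assms(1) by (simp add: power_int_add)
qed

section \<open>Deformed continued fractions as power series\<close>

definition fps_q_nat :: "nat \<Rightarrow> 'a::field fps" where
  "fps_q_nat n = (\<Sum>i<n. fps_X ^ i)"

lemma fps_q_nat_nth: "fps_q_nat n $ i = of_bool (i < n)"
  by (simp add: fps_q_nat_def fps_sum_nth)

lemma fps_int_coeffs_q_nat: "fps_int_coeffs (fps_q_nat n)"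
  by (simp add: fps_int_coeffs_def fps_q_nat_nth)

lemma fls_X_neq_1: "(fls_X :: 'a::field fls) \<noteq> 1"
  by (auto simp: fls_eq_iff intro: exI[of _ 1])

lemma q_int_fls_X: "q_int fls_X (int n) = fps_to_fls (fps_q_nat n)"
proof -
  have "1 - fls_X ^ n = (1 - fls_X) * (fps_to_fls (fps_q_nat n) :: 'a fls)"
    using arg_cong[OF one_diff_power_eq[of "fps_X :: 'a fps" n], of fps_to_fls]
    by (simp add: fps_q_nat_def fps_to_fls_power fls_times_fps_to_fls)
  moreover have "1 - fls_X \<noteq> (0 :: 'a fls)" using fls_X_neq_1 by simp
  ultimately show ?thesis by (simp add: q_int_def)
qed

definition fps_q_step :: "nat \<Rightarrow> nat \<Rightarrow> 'a::field fps \<Rightarrow> 'a fps" where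
  "fps_q_step a b g = fps_q_nat a + fps_X ^ (a + b) * (g / (1 + fps_X * fps_q_nat b * g))"

lemma fps_q_step_low_nth:
  assumes "i \<le> a + b"
  shows "fps_q_step a b g $ i = of_bool (i < a) + (if i = a + b then g $ 0 else 0)"
  using assms
  by (auto simp: fps_q_step_def fps_q_nat_nth fps_X_power_mult_nth fps_divide_unit)

lemma fps_int_coeffs_q_step:
  assumes "fps_int_coeffs g"
  shows "fps_int_coeffs (fps_q_step a b g)"
proof -
  have "fps_int_coeffs (1 + fps_X * fps_q_nat b * g)"
    using assms by (intro fps_int_coeffs_add fps_int_coeffs_mult fps_int_coeffs_1 fps_int_coeffs_X
        fps_int_coeffs_q_nat)
  with assms show ?thesis
    by (simp add: fps_q_step_def fps_int_coeffs_add fps_int_coeffs_mult fps_int_coeffs_divide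
        fps_int_coeffs_X_power fps_int_coeffs_q_nat)
qed

lemma fps_q_step_diff_dvd:
  assumes "fps_X ^ n dvd g - h"
  shows "fps_X ^ (a + b + n) dvd fps_q_step a b g - fps_q_step a b h"
proof -
  define D where "D f = 1 + fps_X * fps_q_nat b * f" for f :: "'a fps"
  have unit: "D f * inverse (D f) = 1" for f
    by (rule inverse_mult_eq_1') (simp add: D_def)
  have "g / D g - h / D h = g * inverse (D g) - h * inverse (D h)"
    by (simp add: fps_divide_unit D_def)
  also have "\<dots> = g * inverse (D g) * (D h * inverse (D h))
      - h * inverse (D h) * (D g * inverse (D g))"
    by (simp add: unit)
  also have "\<dots> = (g * D h - h * D g) * (inverse (D g) * inverse (D h))"
    by (simp add: algebra_simps)
  also have "g * D h - h * D g = g - h"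
    by (simp add: D_def algebra_simps)
  finally have "fps_q_step a b g - fps_q_step a b h
      = fps_X ^ (a + b) * ((g - h) * (inverse (D g) * inverse (D h)))"
    by (simp add: fps_q_step_def flip: D_def right_diff_distrib)
  with assms show ?thesis by (simp add: power_add[of _ "a + b"] mult_dvd_mono)
qed

text \<open>The equation for \<open>[a, b]\<close> reads it as \<open>[a, b - 1, 1]\<close>, which is junk for \<open>b = 0\<close>.\<close>

fun fps_q_cf :: "nat list \<Rightarrow> 'a::field fps" where
  "fps_q_cf [] = 0"
| "fps_q_cf [a] = fps_q_nat a"
| "fps_q_cf [a, b] = fps_q_step a (b - 1) 1"
| "fps_q_cf (a # b # c # cs) = fps_q_step a b (fps_q_cf (c # cs))"

lemma fps_q_cf_nth_0:
  assumes "as \<noteq> []" "0 \<notin> set as"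
  shows "fps_q_cf as $ 0 = 1"
  using assms by (cases as rule: fps_q_cf.cases) (auto simp: fps_q_nat_nth fps_q_step_low_nth)

lemma fps_int_coeffs_q_cf: "fps_int_coeffs (fps_q_cf as)"
  by (induction as rule: fps_q_cf.induct)
    (simp_all add: fps_int_coeffs_0 fps_int_coeffs_1 fps_int_coeffs_q_nat fps_int_coeffs_q_step)

lemma fps_q_cf_low_nth:
  assumes "0 < b" "0 \<notin> set cs" "e = a + b - of_bool (cs = [])" "i \<le> e"
  shows "fps_q_cf (a # b # cs) $ i = of_bool (i < a \<or> i = e)"
proof (cases cs)
  case Nil
  with assms show ?thesis by (auto simp: fps_q_step_low_nth)
next
  case (Cons c ds)
  with assms fps_q_cf_nth_0[of cs] show ?thesis by (auto simp: fps_q_step_low_nth)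
qed

lemma q_cf_fls_X_step:
  assumes "q_cf fls_X bs = fps_to_fls g" "bs \<noteq> []" "g $ 0 = 1"
  shows "q_cf fls_X (int a # int b # bs) = fps_to_fls (fps_q_step a b g)"
proof -
  have exponent: "fls_X powi (int a + int b) = (fls_X ^ (a + b) :: 'a fls)"
    by (metis of_nat_add power_int_of_nat)
  have "q_cf fls_X bs \<noteq> (0 :: 'a fls)" using assms(1,3) by auto
  then have "q_cf fls_X (int a # int b # bs) = fps_to_fls (fps_q_nat a)
      + fls_X ^ (a + b) * (fps_to_fls g / fps_to_fls (1 + fps_X * fps_q_nat b * g))"
    using assms(1,2) q_cf_two_levels[of "fls_X :: 'a fls" bs "int a" "int b"]
    unfolding exponent
    by (simp add: fls_X_neq_1 q_int_fls_X fls_times_fps_to_fls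
        del: q_cf.simps times_divide_eq_right)
  also have "fps_to_fls g / fps_to_fls (1 + fps_X * fps_q_nat b * g)
      = fps_to_fls (g / (1 + fps_X * fps_q_nat b * g))"
    by (rule fls_divide_fps_to_fls) simp
  finally show ?thesis
    by (simp add: fps_q_step_def fls_times_fps_to_fls fps_to_fls_power)
qed

lemma q_cf_fls_X:
  assumes "0 \<notin> set (tl as)"
  shows "q_cf fls_X (map int as) = fps_to_fls (fps_q_cf as)"
  using assms
proof (induction as rule: fps_q_cf.induct [case_names empty single pair step])
  case empty
  show ?case by simp
next
  case (single a)
  show ?case by (simp add: q_int_fls_X)
next
  case (pair a b)
  then have "int (b - 1) + 1 = int b" by simp
  then have "q_cf fls_X [int a, int b] = (q_cf fls_X [int a, int (b - 1), 1] :: 'a fls)"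
    using q_cf_split_last[of fls_X "[int a]" "int (b - 1)"] fls_X_neq_1 by simp
  also have "\<dots> = fps_to_fls (fps_q_step a (b - 1) 1)"
    by (rule q_cf_fls_X_step) (simp_all add: q_int_1 fls_X_neq_1)
  finally show ?case by simp
next
  case (step a b c cs)
  then have "q_cf fls_X (map int (c # cs)) = (fps_to_fls (fps_q_cf (c # cs)) :: 'a fls)" by simp
  moreover have "fps_q_cf (c # cs) $ 0 = (1 :: 'a)" using step by (intro fps_q_cf_nth_0) auto
  ultimately show ?case using q_cf_fls_X_step[of "map int (c # cs)"]
    by (simp del: q_cf.simps)
qed

lemma fps_q_cf_diff_q_nat_dvd:
  "fps_X ^ (a + b - 1) dvd fps_q_cf (a # b # cs) - (fps_q_nat a :: 'a::field fps)"
proof -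
  have step_dvd: "fps_X ^ (a + l) dvd fps_q_step a l g - (fps_q_nat a :: 'a fps)" for l g
    by (simp add: fps_q_step_def)
  show ?thesis by (cases cs) (auto intro: power_le_dvd[OF step_dvd])
qed

lemma fps_q_cf_append_diff_dvd:
  "fps_X ^ (sum_list cs - 1) dvd fps_q_cf (cs @ as) - (fps_q_cf (cs @ bs) :: 'a::field fps)"
proof (induction cs rule: fps_q_cf.induct [case_names empty single pair step])
  case empty
  show ?case by simp
next
  case (single a)
  have "fps_X ^ (a - 1) dvd fps_q_cf (a # ds) - (fps_q_nat a :: 'a fps)" for ds
    by (cases ds) (auto intro: power_le_dvd[OF fps_q_cf_diff_q_nat_dvd])
  from dvd_diff[OF this[of as] this[of bs]] show ?case by simp
next
  case (pair a b)
  from dvd_diff[OF fps_q_cf_diff_q_nat_dvd[of a b as] fps_q_cf_diff_q_nat_dvd[of a b bs]]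
  show ?case by simp
next
  case (step a b c cs)
  from fps_q_step_diff_dvd[OF this, of a b] show ?case
    by (auto intro: power_le_dvd)
qed

section \<open>Truncations of the continued fraction of a real number\<close>

lemma cf_trunc_append:
  assumes "n \<le> m"
  shows "\<exists>as. cf_trunc m x = cf_trunc n x @ as \<and> (as \<noteq> [] \<longrightarrow> length (cf_trunc n x) = Suc n)"
  using assms
proof (induction n arbitrary: m x)
  case 0
  show ?case by (cases m) auto
next
  case (Suc n)
  then obtain l where "m = Suc l" "n \<le> l" by (cases m) auto
  with Suc.IH[of l "1 / frac x"] show ?case by auto
qed

lemma map_int_nat_cf_trunc:
  assumes "0 \<le> x"
  shows "map int (map nat (cf_trunc n x)) = cf_trunc n x"
proof -
  have "0 \<le> hd (cf_trunc n x)" using assms by (cases n) auto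
  moreover have "0 \<le> a" if "a \<in> set (tl (cf_trunc n x))" for a
    using cf_trunc_tl_pos[OF that] by simp
  ultimately have "0 \<le> a" if "a \<in> set (cf_trunc n x)" for a
    using that by (cases "cf_trunc n x") auto
  then show ?thesis by (simp add: map_idI)
qed

lemma zero_notin_tl_map_nat_cf_trunc: "0 \<notin> set (tl (map nat (cf_trunc n x)))"
  using cf_trunc_tl_pos[of _ n x] by (fastforce simp flip: map_tl)

lemma length_le_sum_list: "0 \<notin> set xs \<Longrightarrow> length xs \<le> sum_list (xs :: nat list)"
  by (induction xs) (auto simp: Suc_le_eq)

definition fps_q_trunc :: "nat \<Rightarrow> real \<Rightarrow> 'a::field fps" where
  "fps_q_trunc n x = fps_q_cf (map nat (cf_trunc n x))"

lemma q_cf_cf_trunc: "0 \<le> x \<Longrightarrow> q_cf fls_X (cf_trunc n x) = fps_to_fls (fps_q_trunc n x)"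
  using q_cf_fls_X[OF zero_notin_tl_map_nat_cf_trunc[of n x]]
  by (simp only: map_int_nat_cf_trunc fps_q_trunc_def)

lemma fps_q_trunc_diff_dvd:
  assumes "n \<le> m"
  shows "fps_X ^ (n - 1) dvd fps_q_trunc m x - (fps_q_trunc n x :: 'a::field fps)"
proof -
  obtain as where extension: "cf_trunc m x = cf_trunc n x @ as"
    and full_length: "as \<noteq> [] \<Longrightarrow> length (cf_trunc n x) = Suc n"
    using cf_trunc_append[OF assms] by blast
  show ?thesis
  proof (cases "as = []")
    case True
    with extension show ?thesis by (simp add: fps_q_trunc_def)
  next
    case False
    define cs where "cs = map nat (cf_trunc n x)"
    have "n = length (tl cs)" using full_length[OF False] by (simp add: cs_def)
    also have "\<dots> \<le> sum_list (tl cs)"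
      unfolding cs_def by (rule length_le_sum_list[OF zero_notin_tl_map_nat_cf_trunc])
    also have "\<dots> \<le> sum_list cs" by (cases cs) auto
    finally have "n - 1 \<le> sum_list cs - 1" by simp
    moreover have "fps_X ^ (sum_list cs - 1) dvd fps_q_trunc m x - (fps_q_trunc n x :: 'a fps)"
      using fps_q_cf_append_diff_dvd[of cs "map nat as" "[]"]
      by (simp add: fps_q_trunc_def extension cs_def)
    ultimately show ?thesis by (rule power_le_dvd[rotated])
  qed
qed

lemma convergent_fps_q_trunc: "convergent (\<lambda>n. fps_q_trunc n x :: 'a::field fps)"
proof (rule fps_convergentI)
  fix i
  have "fps_q_trunc n x $ i = fps_q_trunc (i + 2) x $ i" if "i + 2 \<le> n" for n
    by (rule fps_X_power_dvd_imp_nth_eq[OF fps_q_trunc_diff_dvd[OF that]]) simp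
  then show "\<exists>N. \<forall>n\<ge>N. fps_q_trunc n x $ i = fps_q_trunc N x $ i" by blast
qed

lemma q_real_eq_fps_limit:
  assumes "0 \<le> x"
  obtains f where "q_real x = fps_to_fls f" "(\<lambda>n. fps_q_trunc n x) \<longlonglongrightarrow> f"
proof -
  obtain f :: "rat fps" where lim: "(\<lambda>n. fps_q_trunc n x) \<longlonglongrightarrow> f"
    using convergent_fps_q_trunc by (auto simp: convergent_def)
  from tendsto_fps_to_fls[OF this] have "(\<lambda>n. q_cf fls_X (cf_trunc n x)) \<longlonglongrightarrow> fps_to_fls f"
    using assms by (simp add: q_cf_cf_trunc)
  then have "q_real x = fps_to_fls f" unfolding q_real_def by (rule limI)
  then show ?thesis using lim by (rule that)
qed

lemma fps_q_trunc_low_nth: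
  assumes "0 \<le> x" "x \<notin> \<int>" "2 \<le> m" "e = nat \<lfloor>x\<rfloor> + nat \<lceil>1 / frac x\<rceil> - 1" "i \<le> e"
  shows "fps_q_trunc m x $ i = of_bool (i < nat \<lfloor>x\<rfloor> \<or> i = e)"
proof -
  obtain l where m_eq: "m = Suc (Suc l)" using assms(3)
    by (auto simp: numeral_2_eq_2 dest: Suc_le_D)
  define y where "y = 1 / frac x"
  define cs where "cs = (if y \<in> \<int> then [] else map nat (cf_trunc l (1 / frac y)))"
  have "1 < y" using inverse_frac_gt_1[OF assms(2)] by (simp add: y_def)
  have trunc: "map nat (cf_trunc m x) = nat \<lfloor>x\<rfloor> # nat \<lfloor>y\<rfloor> # cs"
    using assms(2) by (simp add: m_eq y_def cs_def)
  have "0 \<notin> set cs" using zero_notin_tl_map_nat_cf_trunc[of m x] by (simp add: trunc)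
  moreover have "e = nat \<lfloor>x\<rfloor> + nat \<lfloor>y\<rfloor> - of_bool (cs = [])"
  proof (cases "y \<in> \<int>")
    case False
    then have "y \<noteq> of_int \<lfloor>y\<rfloor>" by (metis Ints_of_int)
    then have "\<lceil>y\<rceil> = \<lfloor>y\<rfloor> + 1" by (simp add: ceiling_altdef)
    with False \<open>1 < y\<close> assms(4) show ?thesis by (simp add: cs_def nat_add_distrib flip: y_def)
  qed (use assms(4) in \<open>auto simp: cs_def simp flip: y_def elim!: Ints_cases\<close>)
  ultimately show ?thesis
    using \<open>1 < y\<close> assms(5) by (simp add: fps_q_trunc_def trunc fps_q_cf_low_nth)
qed

section \<open>The leading coefficients\<close>

lemma floor_eq_near_nat:
  assumes "0 < n" "real k \<le> x" "x < real k + 1 / real n"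
  shows "\<lfloor>x\<rfloor> = int k"
proof -
  have "1 / real n \<le> 1" using assms(1) by simp
  with assms(2,3) show ?thesis by linarith
qed

lemma ceiling_inverse_frac_near_nat:
  assumes "0 < n" "real k \<le> x" "x < real k + 1 / real n" "x \<notin> \<int>"
  shows "int n < \<lceil>1 / frac x\<rceil>"
    and "\<lceil>1 / frac x\<rceil> = int n + 1 \<longleftrightarrow> real k + 1 / (real n + 1) \<le> x"
proof -
  have frac: "frac x = x - real k" "0 < frac x"
    using floor_eq_near_nat[OF assms(1-3)] assms(4) frac_gt_0_iff[of x] by (simp_all add: frac_def)
  have "frac x < 1 / real n" using assms(3) frac(1) by linarith
  then have inverse_gt: "real n < 1 / frac x" using assms(1) frac(2) by (simp add: field_simps)
  then show "int n < \<lceil>1 / frac x\<rceil>" by (simp add: less_ceiling_iff)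
  have "\<lceil>1 / frac x\<rceil> = int n + 1 \<longleftrightarrow> 1 / frac x \<le> real n + 1"
    using inverse_gt by linarith
  also have "\<dots> \<longleftrightarrow> 1 / (real n + 1) \<le> frac x" using frac(2) by (simp add: field_simps)
  also have "\<dots> \<longleftrightarrow> real k + 1 / (real n + 1) \<le> x" using frac(1) by linarith
  finally show "\<lceil>1 / frac x\<rceil> = int n + 1 \<longleftrightarrow> real k + 1 / (real n + 1) \<le> x" .
qed

lemma fps_q_trunc_low_nth_near_nat:
  assumes "0 < n" "real k \<le> x" "x < real k + 1 / real n" "2 \<le> m" "i \<le> k + n"
  shows "fps_q_trunc m x $ i = of_bool (i < k \<or> i = k + n \<and> real k + 1 / (real n + 1) \<le> x)"
proof (cases "x \<in> \<int>")
  case True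
  then have "x = real k" using floor_eq_near_nat[OF assms(1-3)] by (auto elim!: Ints_cases)
  moreover have "cf_trunc m (real k) = [int k]" by (cases m) auto
  moreover have "0 < 1 / (real n + 1)" by (simp add: add_pos_nonneg)
  ultimately show ?thesis by (simp add: fps_q_trunc_def fps_q_nat_nth)
next
  case False
  have floor: "\<lfloor>x\<rfloor> = int k" by (rule floor_eq_near_nat[OF assms(1-3)])
  note ceiling = ceiling_inverse_frac_near_nat[OF assms(1-3) False]
  define e where "e = nat \<lfloor>x\<rfloor> + nat \<lceil>1 / frac x\<rceil> - 1"
  have "k + n \<le> e" "e = k + n \<longleftrightarrow> real k + 1 / (real n + 1) \<le> x"
    using floor ceiling(1) unfolding e_def ceiling(2)[symmetric] by auto
  moreover have "fps_q_trunc m x $ i = of_bool (i < k \<or> i = e)"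
    using fps_q_trunc_low_nth[OF _ False assms(4) e_def, of i] assms(2,5) floor \<open>k + n \<le> e\<close> by simp
  ultimately show ?thesis using assms(5) by auto
qed

lemma q_real_near_nat:
  assumes "0 < n" "real k \<le> x" "x < real k + 1 / real n"
  obtains f where "q_real x = fps_to_fls f" "fps_int_coeffs f"
    "\<And>i. i \<le> k + n \<Longrightarrow>
      f $ i = of_bool (i < k \<or> i = k + n \<and> real k + 1 / (real n + 1) \<le> x)"
proof -
  have "0 \<le> x" using assms(2) by linarith
  then obtain f where q_real_eq: "q_real x = fps_to_fls f" and lim: "(\<lambda>m. fps_q_trunc m x) \<longlonglongrightarrow> f"
    by (rule q_real_eq_fps_limit)
  have int_coeffs: "fps_int_coeffs f"
    using fps_int_coeffs_limit[OF lim] by (simp add: fps_q_trunc_def fps_int_coeffs_q_cf)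
  have "f $ i = of_bool (i < k \<or> i = k + n \<and> real k + 1 / (real n + 1) \<le> x)"
    (is "_ = ?c") if "i \<le> k + n" for i
  proof -
    have "\<forall>\<^sub>F m in sequentially. fps_q_trunc m x $ i \<in> {?c}"
      using eventually_ge_at_top[of 2]
      by eventually_elim (simp add: fps_q_trunc_low_nth_near_nat[OF assms _ that])
    with fps_nth_limit_mem[OF lim sequentially_bot] have "f $ i \<in> {?c}" .
    then show ?thesis by simp
  qed
  with q_real_eq int_coeffs show ?thesis by (rule that)
qed

theorem theorem2p4:
  fixes x :: real and k n :: nat
  assumes "0 < n" and "real k \<le> x" and "x < real k + 1 / real n"
  shows "\<exists>\<kappa> :: nat \<Rightarrow> int. q_real x = fps_to_fls
    ((\<Sum>i<k. fps_X ^ i)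
      + (if real k + 1 / (real n + 1) \<le> x then fps_X ^ (k + n) else 0)
      + Abs_fps (\<lambda>i. if k + n + 1 \<le> i then of_int (\<kappa> i) else 0))"
proof -
  define leading :: "rat fps" where
    "leading =
      (\<Sum>i<k. fps_X ^ i) + (if real k + 1 / (real n + 1) \<le> x then fps_X ^ (k + n) else 0)"
  have leading_nth:
    "leading $ i = of_bool (i < k \<or> i = k + n \<and> real k + 1 / (real n + 1) \<le> x)" for i
    by (auto simp: leading_def fps_q_nat_nth simp flip: fps_q_nat_def)
  obtain f where "q_real x = fps_to_fls f" "fps_int_coeffs f"
    and "\<And>i. i \<le> k + n \<Longrightarrow> f $ i = leading $ i"
    using q_real_near_nat[OF assms] unfolding leading_nth by blast
  moreover from this have "\<exists>\<kappa>. f = leading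
      + Abs_fps (\<lambda>i. if k + n + 1 \<le> i then of_int (\<kappa> i) else 0)"
    by (intro fps_int_coeffs_split_at) (auto simp: leading_nth)
  ultimately show ?thesis by (auto simp: leading_def)
qed

end
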